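(* Let $n\ge1$ and let $f(x)=(f_1(x_1),\dots,f_n(x_n))$ for $x=(x_1,\dots,x_n)\in\mathbf R^{2n}$, $x_k\in\mathbf R^2$, where each $f_k\in C^1(\mathbf R^2,\mathbf R^2)$ is such that for the planar system $\dot x_k=f_k(x_k)$ the origin is the unique equilibrium point and all other trajectories are closed curves surrounding the origin. Let $g\in C^{0,1}_{t,x}(\mathbf R\times\mathbf R^{2n},\mathbf R^{2n})$, and suppose that for some real $p>1$ at least one of the following (equivalent) assumptions holds: (i) $t^p\|g(t,x)\|\to0$ as $t\to+\infty$, uniformly with respect to $x$ on compact subsets of $\mathbf R^{2n}$; (ii) there are positive continuous scalar functions $\alpha(s)$, $\beta(t)$ with $\alpha$ increasing, $\beta$ decreasing, $\lim_{t\to\infty}\beta(t)=0$, and $t^p\|g(t,x)\|\le\alpha(\|x\|)\beta(t)$. Then the system $\dot x=f(x)+g(t,x)$ has bounded solutions; that is, there exist $t_0$ and a solution $x(t)$ defined for all $t\ge t_0$ with $\sup_{t\ge t_0}\|x(t)\|<\infty$.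
   Context: $C^{0,1}_{t,x}$ denotes functions continuous in $(t,x)$ and continuously differentiable with respect to $x$. $\|\cdot\|$ is the Euclidean norm. *)

theory Defs
  imports "HOL-Analysis.Analysis"
begin

definition C1 :: "('a::real_normed_vector \<Rightarrow> 'b::real_normed_vector) \<Rightarrow> bool" where
  "C1 f \<longleftrightarrow> (\<exists>f' :: 'a \<Rightarrow> 'a \<Rightarrow>\<^sub>L 'b.
     (\<forall>x. (f has_derivative blinfun_apply (f' x)) (at x)) \<and> continuous_on UNIV f')"

(* The class usually written C^{0,1}_{t,x}: both g and its derivative in x are
   continuous jointly in (t,x). *)
definition C01 :: "(real \<Rightarrow> 'a::real_normed_vector \<Rightarrow> 'b::real_normed_vector) \<Rightarrow> bool" where
  "C01 g \<longleftrightarrow> continuous_on UNIV (\<lambda>(t, x). g t x) \<and>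
     (\<exists>g' :: real \<Rightarrow> 'a \<Rightarrow> 'a \<Rightarrow>\<^sub>L 'b.
       (\<forall>t x. (g t has_derivative blinfun_apply (g' t x)) (at x)) \<and>
       continuous_on UNIV (\<lambda>(t, x). g' t x))"

definition solution_on ::
  "(real \<Rightarrow> 'a::real_normed_vector \<Rightarrow> 'a) \<Rightarrow> (real \<Rightarrow> 'a) \<Rightarrow> real set \<Rightarrow> bool" where
  "solution_on F u J \<longleftrightarrow> (\<forall>t\<in>J. (u has_vector_derivative F t (u t)) (at t within J))"

(* A closed trajectory of the autonomous system u' = f(u): the orbit of a
   nonconstant periodic solution. *)
definition closed_trajectory :: "('a::real_normed_vector \<Rightarrow> 'a) \<Rightarrow> 'a set \<Rightarrow> bool" where
  "closed_trajectory f \<Gamma> \<longleftrightarrow>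
     (\<exists>u T. solution_on (\<lambda>_. f) u UNIV \<and> T > 0 \<and> (\<forall>t. u (t + T) = u t) \<and>
            (\<exists>t. u t \<noteq> u 0) \<and> \<Gamma> = range u)"

(* For C^1 fields exactly one trajectory passes through each point, so the second
   conjunct says that every trajectory other than the equilibrium {0} is closed and
   surrounds 0, i.e. 0 lies in a bounded component of the complement of the curve. *)
definition global_center :: "(real^2 \<Rightarrow> real^2) \<Rightarrow> bool" where
  "global_center f \<longleftrightarrow>
     (\<forall>x. f x = 0 \<longleftrightarrow> x = 0) \<and>
     (\<forall>x. x \<noteq> 0 \<longrightarrow> (\<exists>\<Gamma>. closed_trajectory f \<Gamma> \<and> x \<in> \<Gamma> \<and> 0 \<in> inside \<Gamma>))"

end

theory Submission
  imports Defs
begin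

text \<open>By Baire's theorem the periods (and the norms) of the closed orbits of a planar centre are
  bounded on some nonempty open set, hence near one particular orbit. There a perturbation that
  moves the current point by \<open>\<eta>\<close> moves the whole closed orbit through it by at most a constant
  multiple of \<open>\<eta>\<close>. The perturbation \<open>g\<close> is at most \<open>t\<close> to the power \<open>-p\<close> on a compact set, which is
  summable, so a solution that starts on the chosen orbits at a late time stays near them forever.
  Truncating the field by the metric projection onto a product of discs makes it globally
  Lipschitz and decouples the planar components.\<close>

section \<open>Gronwall and Lipschitz estimates\<close>

text \<open>The squared norm is differentiable even where \<open>w\<close> vanishes. Damped by an
  exponential and corrected by a linear term, it is nonincreasing; the cross term with
  \<open>\<eta>\<close> is absorbed by \<open>2 * x * y \<le> x\<^sup>2 + y\<^sup>2\<close>.\<close>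

lemma gronwall_bound:
  fixes w :: "real \<Rightarrow> 'a::real_inner"
  assumes "a \<le> b" "0 \<le> L" "0 \<le> \<eta>"
    and w: "\<And>t. t \<in> {a..b} \<Longrightarrow> (w has_vector_derivative w' t) (at t within {a..b})"
    and w': "\<And>t. t \<in> {a..b} \<Longrightarrow> norm (w' t) \<le> L * norm (w t) + \<eta>"
  shows "norm (w b) \<le> exp ((L + 1) * (b - a)) * (norm (w a) + \<eta> * (1 + (b - a)))"
proof -
  \<comment> \<open>The part \<open>2 * L\<close> compensates the growth of the squared norm and the
    rest absorbs the square left over from the cross term. With this value
    \<open>exp (c * (b - a))\<close> is the square of the factor in the claim.\<close>
  define c where "c = 2 * (L + 1)"
  define \<psi> where "\<psi> t = exp (- c * (t - a)) * (w t \<bullet> w t) - \<eta>\<^sup>2 * (t - a)" for t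
  define \<psi>' where "\<psi>' t = exp (- c * (t - a)) * (2 * (w t \<bullet> w' t) - c * (w t \<bullet> w t)) - \<eta>\<^sup>2" for t
  have d: "(\<psi> has_vector_derivative \<psi>' t) (at t within {a..b})" if "t \<in> {a..b}" for t
    unfolding \<psi>_def \<psi>'_def
    by (rule has_vector_derivative_eq_rhs, (rule derivative_intros w[OF that] bounded_bilinear.has_vector_derivative[OF bounded_bilinear_inner] has_real_derivative_iff_has_vector_derivative[THEN iffD1] | simp)+)
       (auto simp: algebra_simps inner_commute)
  have nonpos: "\<psi>' t \<le> 0" if t: "t \<in> {a..b}" for t
  proof -
    have "w t \<bullet> w' t \<le> norm (w t) * norm (w' t)"
      by (rule norm_cauchy_schwarz)
    also have "\<dots> \<le> norm (w t) * (L * norm (w t) + \<eta>)"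
      using w'[OF t] by (intro mult_left_mono) auto
    finally have "2 * (w t \<bullet> w' t) \<le> 2 * L * (norm (w t))\<^sup>2 + 2 * norm (w t) * \<eta>"
      by (simp add: algebra_simps power2_eq_square)
    moreover have "2 * norm (w t) * \<eta> \<le> (norm (w t))\<^sup>2 + \<eta>\<^sup>2"
      by (rule sum_squares_bound)
    ultimately have "2 * (w t \<bullet> w' t) - c * (w t \<bullet> w t) \<le> \<eta>\<^sup>2 - (norm (w t))\<^sup>2"
      unfolding c_def by (simp add: power2_norm_eq_inner algebra_simps)
    then have *: "2 * (w t \<bullet> w' t) - c * (w t \<bullet> w t) \<le> \<eta>\<^sup>2"
      using zero_le_power2[of "norm (w t)"] by linarith
    have "exp (- c * (t - a)) * (2 * (w t \<bullet> w' t) - c * (w t \<bullet> w t)) \<le> exp (- c * (t - a)) * \<eta>\<^sup>2"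
      using * by (intro mult_left_mono) auto
    also have "\<dots> \<le> 1 * \<eta>\<^sup>2"
      using t \<open>0 \<le> L\<close> by (intro mult_right_mono) (auto simp: c_def intro!: mult_nonpos_nonneg)
    finally show ?thesis unfolding \<psi>'_def by simp
  qed
  have "\<psi> b \<le> \<psi> a"
  proof (rule DERIV_nonpos_imp_decreasing_open[OF \<open>a \<le> b\<close>])
    show "continuous_on {a..b} \<psi>"
      by (rule continuous_on_vector_derivative[OF d])
    show "\<exists>y. DERIV \<psi> x :> y \<and> y \<le> 0" if "a < x" "x < b" for x
      using d[of x] nonpos[of x] that
      by (auto simp: at_within_Icc_at has_real_derivative_iff_has_vector_derivative intro!: exI[of _ "\<psi>' x"])
  qed
  then have "exp (- c * (b - a)) * (norm (w b))\<^sup>2 \<le> (norm (w a))\<^sup>2 + \<eta>\<^sup>2 * (b - a)"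
    by (simp add: \<psi>_def power2_norm_eq_inner)
  \<comment> \<open>A crude completion to a perfect square, so that a square root can be taken at
    the end.\<close>
  also have "\<dots> \<le> (norm (w a) + \<eta> * (1 + (b - a)))\<^sup>2"
  proof -
    have "b - a \<le> (1 + (b - a))\<^sup>2"
      using \<open>a \<le> b\<close> by (simp add: power2_sum add_increasing2)
    then have "\<eta>\<^sup>2 * (b - a) \<le> (\<eta> * (1 + (b - a)))\<^sup>2"
      by (metis mult_left_mono power_mult_distrib zero_le_power2)
    moreover have "0 \<le> norm (w a) * (\<eta> * (1 + (b - a)))"
      using assms(1,3) by simp
    ultimately show ?thesis
      by (simp add: power2_sum)
  qed
  finally have "exp (c * (b - a)) * (exp (- (c * (b - a))) * (norm (w b))\<^sup>2)
      \<le> exp (c * (b - a)) * (norm (w a) + \<eta> * (1 + (b - a)))\<^sup>2"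
    by (intro mult_left_mono) simp_all
  then have "(norm (w b))\<^sup>2 \<le> exp (c * (b - a)) * (norm (w a) + \<eta> * (1 + (b - a)))\<^sup>2"
    by (simp add: exp_minus mult.assoc[symmetric])
  also have "exp (c * (b - a)) = (exp ((L + 1) * (b - a)))\<^sup>2"
    by (simp add: c_def flip: exp_double)
  finally have "(norm (w b))\<^sup>2 \<le> (exp ((L + 1) * (b - a)) * (norm (w a) + \<eta> * (1 + (b - a))))\<^sup>2"
    by (simp add: power_mult_distrib)
  then show ?thesis
    by (rule power2_le_imp_le) (use assms(1,3) in auto)
qed

lemma C1_lipschitz_cball:
  fixes f :: "'a::euclidean_space \<Rightarrow> 'b::real_normed_vector"
  assumes "C1 f"
  obtains L where "L > 0" "\<And>x y. x \<in> cball 0 R \<Longrightarrow> y \<in> cball 0 R \<Longrightarrow> norm (f x - f y) \<le> L * norm (x - y)"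
proof -
  obtain f' where f': "\<And>x. (f has_derivative blinfun_apply (f' x)) (at x)" "continuous_on UNIV f'"
    using assms unfolding C1_def by blast
  have "bounded (f' ` cball 0 R)"
    by (meson compact_cball compact_continuous_image compact_imp_bounded continuous_on_subset f'(2) subset_UNIV)
  then obtain L where L: "L > 0" "\<And>x. x \<in> cball 0 R \<Longrightarrow> norm (f' x) \<le> L"
    unfolding bounded_pos by blast
  have "norm (f x - f y) \<le> L * norm (x - y)" if "x \<in> cball 0 R" "y \<in> cball 0 R" for x y
    by (rule differentiable_bound[OF convex_cball[of 0 R], where f' = "\<lambda>x. blinfun_apply (f' x)"])
       (use f' L that in \<open>auto simp: norm_blinfun.rep_eq[symmetric] intro: has_derivative_at_withinI\<close>)
  with L(1) show thesis by (rule that)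
qed

lemma C1_continuous: "C1 f \<Longrightarrow> continuous_on UNIV f"
  unfolding C1_def by (meson has_derivative_continuous continuous_at_imp_continuous_on)

text \<open>The derivative in \<open>x\<close> is jointly continuous, hence bounded on the compact
  set \<open>{a..b} \<times> K\<close>; the mean value inequality on the convex \<open>K\<close>
  then gives one constant for all these times.\<close>

lemma C01_lipschitz_compact:
  fixes g :: "real \<Rightarrow> 'a::real_normed_vector \<Rightarrow> 'b::real_normed_vector"
  assumes "C01 g" "compact K" "convex K"
  obtains L where "L > 0"
    "\<And>t x y. t \<in> {a..b} \<Longrightarrow> x \<in> K \<Longrightarrow> y \<in> K \<Longrightarrow> norm (g t x - g t y) \<le> L * norm (x - y)"
proof -
  obtain g' where g': "\<And>t x. (g t has_derivative blinfun_apply (g' t x)) (at x)"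
      "continuous_on UNIV (\<lambda>(t, x). g' t x)"
    using assms unfolding C01_def by blast
  have "bounded ((\<lambda>(t, x). g' t x) ` ({a..b} \<times> K))"
    by (intro compact_imp_bounded compact_continuous_image compact_Times assms compact_Icc
          continuous_on_subset[OF g'(2)]) auto
  then obtain L where L: "L > 0" "\<And>t x. t \<in> {a..b} \<Longrightarrow> x \<in> K \<Longrightarrow> norm (g' t x) \<le> L"
    unfolding bounded_pos by fastforce
  have "norm (g t x - g t y) \<le> L * norm (x - y)" if "t \<in> {a..b}" "x \<in> K" "y \<in> K" for t x y
    by (rule differentiable_bound[OF \<open>convex K\<close>, where f' = "\<lambda>x. blinfun_apply (g' t x)"])
       (use g' L that in \<open>auto simp: norm_blinfun.rep_eq[symmetric] intro: has_derivative_at_withinI\<close>)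
  with L(1) show thesis by (rule that)
qed

section \<open>Existence of solutions for globally Lipschitz fields\<close>

text \<open>Contraction principle in the norm weighted by \<open>exp (- 2 * L * (t - a))\<close>, in which the integral operator
  has Lipschitz constant \<open>1/2\<close> whatever the length of the interval.\<close>

lemma picard_lindelof_Icc:
  fixes F :: "real \<Rightarrow> 'a::banach \<Rightarrow> 'a"
  assumes "a \<le> b" "L > 0"
    and cont: "continuous_on ({a..b} \<times> UNIV) (\<lambda>(t, x). F t x)"
    and lip: "\<And>t x y. t \<in> {a..b} \<Longrightarrow> norm (F t x - F t y) \<le> L * norm (x - y)"
  shows "\<exists>u. u a = x0 \<and> solution_on F u {a..b}"
proof -
  define E where "E t = exp (2 * L * (t - a))" for t
  \<comment> \<open>Clamping time to \<open>{a..b}\<close> extends functions on the interval to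
    bounded continuous functions on the line, the complete space in which the fixed point is
    sought.\<close>
  define c where "c t = max a (min b t)" for t
  \<comment> \<open>The unknown is \<open>w = u / E\<close> for the solution \<open>u\<close>, so
    the plain supremum norm of \<open>w\<close> is the weighted norm of \<open>u\<close>.\<close>
  define G where "G w t = x0 + integral {a..t} (\<lambda>s. F s (E s *\<^sub>R apply_bcontfun w s))" for w t
  have c: "c t \<in> {a..b}" for t
    using \<open>a \<le> b\<close> by (auto simp: c_def)
  have contE: "continuous_on S E" for S
    unfolding E_def by (intro continuous_intros)
  have E_pos: "E t > 0" for t
    by (simp add: E_def)
  have contw: "continuous_on S (apply_bcontfun w)" for S and w :: "real \<Rightarrow>\<^sub>C 'a"
    by (rule continuous_on_apply_bcontfun continuous_on_subset)+ auto
  have contF: "continuous_on {a..b} (\<lambda>s. F s (E s *\<^sub>R apply_bcontfun w s))" for w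
    by (rule continuous_on_compose2[OF cont, where f = "\<lambda>s. (s, E s *\<^sub>R apply_bcontfun w s)", simplified])
       (auto intro!: continuous_intros contE contw)
  have Gder: "(G w has_vector_derivative F t (E t *\<^sub>R apply_bcontfun w t)) (at t within {a..b})"
    if "t \<in> {a..b}" for w t
    unfolding G_def using integral_has_vector_derivative[OF contF that, of w]
    by (auto intro!: derivative_eq_intros)
  have contG: "continuous_on {a..b} (G w)" for w
    by (rule continuous_on_vector_derivative[OF Gder])
  have contc: "continuous_on UNIV c"
    unfolding c_def by (intro continuous_intros)
  have contH: "continuous_on UNIV (\<lambda>t. (1 / E (c t)) *\<^sub>R G w (c t))" for w
    by (intro continuous_intros continuous_on_compose2[OF contE contc] continuous_on_compose2[OF contG contc])
       (use c E_pos in \<open>auto simp: less_imp_neq[THEN not_sym]\<close>)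
  have bddH: "bounded (range (\<lambda>t. (1 / E (c t)) *\<^sub>R G w (c t)))" for w
  proof -
    have "compact ((\<lambda>t. (1 / E t) *\<^sub>R G w t) ` {a..b})"
      by (intro compact_continuous_image continuous_intros contE contG)
         (use E_pos in \<open>auto simp: less_imp_neq[THEN not_sym]\<close>)
    then show ?thesis
      by (rule bounded_subset[OF compact_imp_bounded]) (use c in auto)
  qed
  define H where "H w = Bcontfun (\<lambda>t. (1 / E (c t)) *\<^sub>R G w (c t))" for w
  have H: "apply_bcontfun (H w) t = (1 / E (c t)) *\<^sub>R G w (c t)" for w t
    unfolding H_def by (subst Bcontfun_inverse) (auto simp: bcontfun_def contH bddH)
  have "dist (H v) (H w) \<le> 1/2 * dist v w" for v w
  proof (rule dist_bound)
    fix t :: real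
    let ?D = "dist v w" and ?r = "c t"
    have sub: "{a..?r} \<subseteq> {a..b}" using c by auto
    have intF: "(\<lambda>s. F s (E s *\<^sub>R apply_bcontfun x s)) integrable_on {a..?r}" for x
      by (intro integrable_continuous_interval continuous_on_subset[OF contF sub])
    \<comment> \<open>The derivative of \<open>E\<close> is \<open>2 * L * E\<close>, so the
      integral gains the factor 1/2; the division by \<open>E\<close> in \<open>H\<close> then
      removes the growth.\<close>
    have EI: "((\<lambda>s. L * ?D * E s) has_integral ?D / 2 * E ?r - ?D / 2 * E a) {a..?r}"
    proof (rule fundamental_theorem_of_calculus)
      show "a \<le> ?r" using c by auto
      show "((\<lambda>s. ?D / 2 * E s) has_vector_derivative L * ?D * E x) (at x within {a..?r})" for x
        unfolding E_def
        by (auto intro!: derivative_eq_intros simp flip: has_real_derivative_iff_has_vector_derivative)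
    qed
    have "norm (G v ?r - G w ?r)
        = norm (integral {a..?r} (\<lambda>s. F s (E s *\<^sub>R apply_bcontfun v s) - F s (E s *\<^sub>R apply_bcontfun w s)))"
      unfolding G_def by (simp add: integral_diff intF)
    also have "\<dots> \<le> integral {a..?r} (\<lambda>s. L * ?D * E s)"
    proof (rule integral_norm_bound_integral)
      fix s assume s: "s \<in> {a..?r}"
      have "norm (F s (E s *\<^sub>R apply_bcontfun v s) - F s (E s *\<^sub>R apply_bcontfun w s))
        \<le> L * norm (E s *\<^sub>R apply_bcontfun v s - E s *\<^sub>R apply_bcontfun w s)"
        using s sub by (intro lip) auto
      also have "\<dots> = L * (E s * dist (apply_bcontfun v s) (apply_bcontfun w s))"
        using E_pos[of s] by (simp add: dist_norm flip: scaleR_diff_right)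
      also have "\<dots> \<le> L * (E s * ?D)"
        using E_pos[of s] \<open>L > 0\<close> by (intro mult_left_mono dist_bounded) auto
      finally show "norm (F s (E s *\<^sub>R apply_bcontfun v s) - F s (E s *\<^sub>R apply_bcontfun w s)) \<le> L * ?D * E s"
        by (simp add: mult_ac)
    qed (use EI in \<open>auto intro!: integrable_diff intF\<close>)
    also have "\<dots> = ?D / 2 * E ?r - ?D / 2 * E a"
      using EI by (rule integral_unique)
    also have "\<dots> \<le> ?D / 2 * E ?r"
      using E_pos[of a] by simp
    finally have "norm (G v ?r - G w ?r) \<le> ?D / 2 * E ?r" .
    moreover have "dist (apply_bcontfun (H v) t) (apply_bcontfun (H w) t) = norm (G v ?r - G w ?r) / E ?r"
      using E_pos[of ?r] by (simp add: H dist_norm flip: scaleR_diff_right)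
    moreover have "norm (G v ?r - G w ?r) / E ?r \<le> (?D / 2 * E ?r) / E ?r"
      using calculation E_pos[of ?r] by (intro divide_right_mono) auto
    ultimately show "dist (apply_bcontfun (H v) t) (apply_bcontfun (H w) t) \<le> 1/2 * ?D"
      using E_pos[of ?r] by simp
  qed
  then obtain w where "H w = w"
    using banach_fix_type[of "1/2" H] by auto
  then have w: "E t *\<^sub>R apply_bcontfun w t = G w t" if "t \<in> {a..b}" for t
    using H[of w t] E_pos[of t] that by (auto simp: c_def)
  have "solution_on F (G w) {a..b}"
    unfolding solution_on_def using Gder[of _ w] w by simp
  moreover have "G w a = x0"
    by (simp add: G_def)
  ultimately show ?thesis by blast
qed

lemma solution_on_subset: "solution_on F u J \<Longrightarrow> I \<subseteq> J \<Longrightarrow> solution_on F u I"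
  unfolding solution_on_def by (meson has_vector_derivative_within_subset subsetD)

text \<open>Solutions on the intervals of length \<open>n\<close> agree on overlaps, by the Gronwall
  estimate with zero forcing, and are glued together. The Lipschitz constant may depend on the right
  endpoint.\<close>

lemma picard_lindelof_atLeast:
  fixes F :: "real \<Rightarrow> 'a::euclidean_space \<Rightarrow> 'a"
  assumes cont: "continuous_on UNIV (\<lambda>(t, x). F t x)"
    and lip: "\<And>b. \<exists>L>0. \<forall>t\<in>{a..b}. \<forall>x y. norm (F t x - F t y) \<le> L * norm (x - y)"
  shows "\<exists>u. u a = x0 \<and> solution_on F u {a..}"
proof -
  have "\<exists>u. u a = x0 \<and> solution_on F u {a..a + real n}" for n
  proof -
    obtain L where "L > 0" "\<forall>t\<in>{a..a + real n}. \<forall>x y. norm (F t x - F t y) \<le> L * norm (x - y)"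
      using lip by blast
    then show ?thesis
      by (intro picard_lindelof_Icc[of _ _ L]) (auto intro: continuous_on_subset[OF cont])
  qed
  then obtain v where v: "\<And>n. v n a = x0" "\<And>n. solution_on F (v n) {a..a + real n}"
    by metis
  have unique: "v n t = v m t" if "n \<le> m" "t \<in> {a..a + real n}" for n m t
  proof -
    obtain L where L: "L > 0" "\<forall>t\<in>{a..a + real n}. \<forall>x y. norm (F t x - F t y) \<le> L * norm (x - y)"
      using lip by blast
    have sol: "solution_on F (v n) {a..t}" "solution_on F (v m) {a..t}"
      using that by (auto intro: solution_on_subset[OF v(2)])
    have "norm (v n t - v m t) \<le> exp ((L + 1) * (t - a)) * (norm (v n a - v m a) + 0 * (1 + (t - a)))"
    proof (rule gronwall_bound[where w = "\<lambda>s. v n s - v m s" and w' = "\<lambda>s. F s (v n s) - F s (v m s)"])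
      show "((\<lambda>s. v n s - v m s) has_vector_derivative F s (v n s) - F s (v m s)) (at s within {a..t})"
        if "s \<in> {a..t}" for s
        using sol that unfolding solution_on_def by (intro has_vector_derivative_diff) auto
    qed (use L that in auto)
    then show ?thesis by (simp add: v)
  qed
  define u where "u t = v (nat \<lceil>t - a\<rceil>) t" for t
  have u: "u t = v n t" if "t \<in> {a..a + real n}" for n t
  proof -
    have "nat \<lceil>t - a\<rceil> \<le> n"
      using that by (simp add: nat_le_iff ceiling_le_iff)
    moreover have "t \<le> a + real (nat \<lceil>t - a\<rceil>)"
      using that by (simp add: algebra_simps) linarith
    ultimately show ?thesis
      unfolding u_def using that by (intro unique) auto
  qed
  have "solution_on F u {a..}"
    unfolding solution_on_def
  proof
    fix t assume t: "t \<in> {a..}"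
    obtain n where n: "t < a + real n"
      using reals_Archimedean2[of "t - a"] by (auto simp: algebra_simps)
    have "(v n has_vector_derivative F t (v n t)) (at t within {a..a + real n})"
      using v(2)[of n] t n unfolding solution_on_def by auto
    \<comment> \<open>As \<open>n\<close> was chosen with \<open>t\<close> strictly below the right
      end, that end is invisible near \<open>t\<close>.\<close>
    moreover have "at t within {a..a + real n} = at t within {a..}"
      by (rule at_within_nhd[of _ "{..<a + real n}"]) (use n in auto)
    ultimately have "(v n has_vector_derivative F t (v n t)) (at t within {a..})"
      by simp
    moreover have "F t (v n t) = F t (u t)"
      using u[of t n] t n by simp
    moreover have "v n s = u s" if "s \<in> {a..}" "dist s t < a + real n - t" for s
      using that by (intro u[symmetric]) (auto simp: dist_real_def)
    ultimately show "(u has_vector_derivative F t (u t)) (at t within {a..})"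
      using t n has_vector_derivative_transform_within[of "v n" "F t (u t)" t "{a..}" "a + real n - t" u]
      by simp
  qed
  moreover have "u a = x0"
    by (simp add: u_def v)
  ultimately show ?thesis by blast
qed

section \<open>Periodic orbits with bounded period and norm\<close>

text \<open>\<open>T\<close> is any period, not the minimal one, so equilibria may qualify. The
  lower bound 1 can always be met by passing to a multiple, and it keeps limits of periods away from
  0.\<close>

definition tame_orbit :: "('a::euclidean_space \<Rightarrow> 'a) \<Rightarrow> real \<Rightarrow> (real \<Rightarrow> 'a) \<Rightarrow> bool" where
  "tame_orbit f N u \<longleftrightarrow> solution_on (\<lambda>_. f) u UNIV \<and>
     (\<exists>T. 1 \<le> T \<and> T \<le> N \<and> (\<forall>t. u (t + T) = u t)) \<and> (\<forall>t. norm (u t) \<le> N)"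

definition tame_points :: "('a::euclidean_space \<Rightarrow> 'a) \<Rightarrow> real \<Rightarrow> 'a set" where
  "tame_points f N = {u 0 |u. tame_orbit f N u}"

lemma tame_orbit_deriv: "tame_orbit f N u \<Longrightarrow> (u has_vector_derivative f (u t)) (at t within S)"
  unfolding tame_orbit_def solution_on_def by (auto intro: has_vector_derivative_at_within)

lemma tame_orbit_norm: "tame_orbit f N u \<Longrightarrow> norm (u t) \<le> N"
  unfolding tame_orbit_def by auto

lemma tame_orbit_mono: "tame_orbit f N u \<Longrightarrow> N \<le> M \<Longrightarrow> tame_orbit f M u"
  unfolding tame_orbit_def by (meson order_trans)

lemma has_vector_derivative_shift_real:
  fixes u :: "real \<Rightarrow> 'a::real_normed_vector"
  assumes "(u has_vector_derivative u') (at (t + s))"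
  shows "((\<lambda>t. u (t + s)) has_vector_derivative u') (at t)"
proof -
  have "((\<lambda>t. t + s) has_vector_derivative 1) (at t)"
    by (auto intro!: derivative_eq_intros)
  from vector_diff_chain_at[OF this, of u u'] assms show ?thesis
    by (simp add: o_def)
qed

lemma tame_orbit_shift:
  assumes "tame_orbit f N u"
  shows "tame_orbit f N (\<lambda>t. u (t + s))"
proof -
  obtain T where T: "1 \<le> T" "T \<le> N" "\<And>t. u (t + T) = u t"
    using assms unfolding tame_orbit_def by auto
  have "u (t + T + s) = u (t + s)" for t
    using T(3)[of "t + s"] by (simp add: algebra_simps)
  then show ?thesis
    using T assms unfolding tame_orbit_def solution_on_def
    by (auto intro!: has_vector_derivative_shift_real)
qed

lemma tame_orbit_in_points: "tame_orbit f N u \<Longrightarrow> u t \<in> tame_points f N"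
  unfolding tame_points_def by (auto intro!: exI[of _ "\<lambda>s. u (s + t)"] tame_orbit_shift)

lemma periodic_int_multiple:
  fixes u :: "real \<Rightarrow> 'a"
  assumes "\<And>t. u (t + T) = u t"
  shows "u (t + of_int n * T) = u t"
proof -
  have nat: "u (t + real m * T) = u t" for m t
  proof (induction m)
    case (Suc m)
    have "u (t + real (Suc m) * T) = u ((t + real m * T) + T)"
      by (simp add: algebra_simps)
    with Suc assms show ?case by simp
  qed simp
  show ?thesis
  proof (cases "n \<ge> 0")
    case True
    then show ?thesis using nat[of t "nat n"] by simp
  next
    case False
    then show ?thesis using nat[of "t + of_int n * T" "nat (- n)"] by simp
  qed
qed

text \<open>Reduces arbitrary times to a bounded range, which turns exponential estimates in time
  into a constant that serves the whole orbit.\<close>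

lemma tame_orbit_wrap:
  assumes "tame_orbit f N u"
  obtains s where "s \<in> {0..N}" "u s = u t"
proof -
  obtain T where T: "1 \<le> T" "T \<le> N" "\<And>t. u (t + T) = u t"
    using assms unfolding tame_orbit_def by auto
  define s where "s = t - of_int \<lfloor>t / T\<rfloor> * T"
  have "0 \<le> s" "s \<le> T"
    using T(1) floor_divide_lower[of T t] floor_divide_upper[of T t] by (auto simp: s_def algebra_simps)
  moreover have "u s = u t"
    using periodic_int_multiple[of u T, OF T(3), of t "- \<lfloor>t / T\<rfloor>"] by (simp add: s_def)
  ultimately show thesis
    using T(2) by (intro that[of s]) auto
qed

lemma tame_orbit_dist_forward:
  assumes u: "tame_orbit f N u" and v: "tame_orbit f N v" and "L > 0" "s \<le> t"
    and lip: "\<And>x y. x \<in> cball 0 N \<Longrightarrow> y \<in> cball 0 N \<Longrightarrow> norm (f x - f y) \<le> L * norm (x - y)"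
  shows "norm (u t - v t) \<le> exp ((L + 1) * (t - s)) * norm (u s - v s)"
proof -
  have "norm (u t - v t) \<le> exp ((L + 1) * (t - s)) * (norm (u s - v s) + 0 * (1 + (t - s)))"
    by (rule gronwall_bound[where w = "\<lambda>r. u r - v r" and w' = "\<lambda>r. f (u r) - f (v r)"])
       (use assms tame_orbit_norm[OF u] tame_orbit_norm[OF v] in
         \<open>auto intro!: has_vector_derivative_diff tame_orbit_deriv[OF u] tame_orbit_deriv[OF v]\<close>)
  then show ?thesis by simp
qed

text \<open>Time reversal lets the forward Gronwall estimate control orbits backward in time as
  well.\<close>

lemma tame_orbit_reverse:
  assumes "tame_orbit f N u"
  shows "tame_orbit (\<lambda>x. - f x) N (\<lambda>t. u (- t))"
proof -
  obtain T where T: "1 \<le> T" "T \<le> N" "\<And>t. u (t + T) = u t"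
    using assms unfolding tame_orbit_def by auto
  have "((\<lambda>t. u (- t)) has_vector_derivative - f (u (- t))) (at t)" for t
  proof -
    have "(uminus has_vector_derivative - 1) (at t)"
      by (auto intro!: derivative_eq_intros)
    from vector_diff_chain_at[OF this, of u "f (u (- t))"] tame_orbit_deriv[OF assms, of "- t" UNIV]
    show ?thesis by (simp add: o_def)
  qed
  moreover have "u (- (t + T)) = u (- t)" for t
    using T(3)[of "- t - T"] by simp
  ultimately show ?thesis
    using T assms unfolding tame_orbit_def solution_on_def by auto
qed

lemma tame_orbit_dist:
  assumes u: "tame_orbit f N u" and v: "tame_orbit f N v" and "L > 0"
    and lip: "\<And>x y. x \<in> cball 0 N \<Longrightarrow> y \<in> cball 0 N \<Longrightarrow> norm (f x - f y) \<le> L * norm (x - y)"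
  shows "norm (u t - v t) \<le> exp ((L + 1) * \<bar>t - s\<bar>) * norm (u s - v s)"
proof (cases "s \<le> t")
  case True
  then show ?thesis using tame_orbit_dist_forward[OF assms(1-3) True lip] by simp
next
  case False
  have "norm (u (- (- t)) - v (- (- t))) \<le> exp ((L + 1) * (- t - (- s))) * norm (u (- (- s)) - v (- (- s)))"
    by (rule tame_orbit_dist_forward[OF tame_orbit_reverse[OF u] tame_orbit_reverse[OF v] \<open>L > 0\<close>])
       (use False lip in \<open>auto simp: norm_minus_commute\<close>)
  with False show ?thesis by simp
qed

lemma tame_orbit_unique:
  assumes "C1 f" "tame_orbit f N u" "tame_orbit f N v" "u s = v s"
  shows "u t = v t"
proof -
  obtain L where L: "L > 0" "\<And>x y. x \<in> cball 0 N \<Longrightarrow> y \<in> cball 0 N \<Longrightarrow> norm (f x - f y) \<le> L * norm (x - y)"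
    using C1_lipschitz_cball[OF assms(1)] by metis
  show ?thesis
    using tame_orbit_dist[OF assms(2,3) L, of t s] assms(4) by simp
qed

section \<open>Baire category and an open set of tame orbits\<close>

text \<open>Orbits through convergent points converge pointwise to the orbit through the limit.
  Their periods lie in the compact interval \<open>{1..N}\<close>, and a subsequential limit of them
  is a period of the limit orbit.\<close>

lemma closed_tame_points:
  assumes "C1 f" and cover: "\<And>b. \<exists>M. b \<in> tame_points f M"
  shows "closed (tame_points f N)"
  unfolding closed_sequential_limits
proof (intro allI impI, elim conjE)
  fix x :: "nat \<Rightarrow> 'a" and b
  assume x: "\<forall>n. x n \<in> tame_points f N" and lim: "x \<longlonglongrightarrow> b"
  \<comment> \<open>The limit orbit comes from \<open>cover\<close> with its own constant
    \<open>M\<close>; what remains is to improve \<open>M\<close> to \<open>N\<close>.\<close>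
  obtain u M where u: "tame_orbit f M u" "u 0 = b"
    using cover[of b] unfolding tame_points_def by auto
  have "\<forall>n. \<exists>v T. tame_orbit f N v \<and> v 0 = x n \<and> T \<in> {1..N} \<and> (\<forall>t. v (t + T) = v t)"
  proof
    fix n
    obtain v where v: "tame_orbit f N v" "x n = v 0"
      using x unfolding tame_points_def by blast
    then obtain T where "1 \<le> T" "T \<le> N" "\<forall>t. v (t + T) = v t"
      unfolding tame_orbit_def by blast
    with v show "\<exists>v T. tame_orbit f N v \<and> v 0 = x n \<and> T \<in> {1..N} \<and> (\<forall>t. v (t + T) = v t)"
      by (intro exI[of _ v] exI[of _ T]) simp
  qed
  then obtain v T where v: "\<And>n. tame_orbit f N (v n)" "\<And>n. v n 0 = x n"
    and T: "\<And>n. T n \<in> {1..N}" "\<And>n t. v n (t + T n) = v n t"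
    by metis
  obtain L where L: "L > 0" "\<And>x y. x \<in> cball 0 (max M N) \<Longrightarrow> y \<in> cball 0 (max M N) \<Longrightarrow> norm (f x - f y) \<le> L * norm (x - y)"
    using C1_lipschitz_cball[OF assms(1)] by metis
  have vM: "tame_orbit f (max M N) (v n)" and uM: "tame_orbit f (max M N) u" for n
    by (auto intro: tame_orbit_mono[OF v(1)] tame_orbit_mono[OF u(1)])
  have dist: "norm (v n t - u t) \<le> exp ((L + 1) * \<bar>t\<bar>) * norm (x n - b)" for n t
    using tame_orbit_dist[OF vM uM L, where t = t and s = 0] v(2) u(2)
    by simp
  have lim0: "(\<lambda>n. c * norm (x n - b)) \<longlonglongrightarrow> 0" for c
    using tendsto_mult_right_zero[OF tendsto_norm_zero[OF LIM_zero[OF lim]]] by simp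
  have vu: "(\<lambda>n. v n t) \<longlonglongrightarrow> u t" for t
    by (rule LIM_zero_cancel, rule Lim_null_comparison[OF always_eventually[OF allI[OF dist]] lim0])
  obtain S r where r: "S \<in> {1..N}" "strict_mono r" "(T \<circ> r) \<longlonglongrightarrow> S"
    using compact_Icc[of 1 N] T(1) unfolding compact_def by metis
  have contu: "isCont u t" for t
    using tame_orbit_deriv[OF u(1), of t UNIV] has_vector_derivative_continuous by blast
  have "u (t + S) = u t" for t
  proof -
    have 1: "(\<lambda>n. u (t + T (r n))) \<longlonglongrightarrow> u (t + S)"
      using r(3) by (intro isCont_tendsto_compose[OF contu] tendsto_intros) (simp add: o_def)
    \<comment> \<open>The evaluation time varies with \<open>n\<close>, so pointwise convergence is
      not enough; the times are bounded by \<open>\<bar>t\<bar> + N\<close>, which makes the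
      exponential factor uniform.\<close>
    have "(\<lambda>n. v (r n) (t + T (r n)) - u (t + T (r n))) \<longlonglongrightarrow> 0"
    proof (rule Lim_null_comparison)
      show "\<forall>\<^sub>F n in sequentially. norm (v (r n) (t + T (r n)) - u (t + T (r n)))
          \<le> exp ((L + 1) * (\<bar>t\<bar> + N)) * norm (x (r n) - b)"
      proof (rule always_eventually, rule allI)
        fix n
        have "\<bar>t + T (r n)\<bar> \<le> \<bar>t\<bar> + N" using T(1)[of "r n"] by auto
        then have "exp ((L + 1) * \<bar>t + T (r n)\<bar>) \<le> exp ((L + 1) * (\<bar>t\<bar> + N))"
          using \<open>L > 0\<close> by simp
        then show "norm (v (r n) (t + T (r n)) - u (t + T (r n)))
          \<le> exp ((L + 1) * (\<bar>t\<bar> + N)) * norm (x (r n) - b)"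
          by (rule order_trans[OF dist mult_right_mono]) simp
      qed
      show "(\<lambda>n. exp ((L + 1) * (\<bar>t\<bar> + N)) * norm (x (r n) - b)) \<longlonglongrightarrow> 0"
        using LIMSEQ_subseq_LIMSEQ[OF lim0 r(2)] by (simp add: o_def)
    qed
    from tendsto_add[OF this 1] have "(\<lambda>n. v (r n) t) \<longlonglongrightarrow> u (t + S)"
      by (simp add: T(2))
    moreover have "(\<lambda>n. v (r n) t) \<longlonglongrightarrow> u t"
      using LIMSEQ_subseq_LIMSEQ[OF vu r(2)] by (simp add: o_def)
    ultimately show ?thesis
      using LIMSEQ_unique by blast
  qed
  moreover have "norm (u t) \<le> N" for t
    by (rule tendsto_upperbound[OF tendsto_norm[OF vu]])
       (use tame_orbit_norm[OF v(1)] in auto)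
  ultimately have "tame_orbit f N u"
    using u(1) r(1) unfolding tame_orbit_def by auto
  with u(2) show "b \<in> tame_points f N"
    unfolding tame_points_def by blast
qed

text \<open>The closed sets for natural \<open>N\<close> cover the space because the sets grow with
  \<open>N\<close>; by Baire they cannot all have empty interior.\<close>

lemma interior_tame_points_nonempty:
  assumes "C1 f" and cover: "\<And>b. \<exists>M. b \<in> tame_points f M"
  obtains N where "interior (tame_points f N) \<noteq> {}"
proof (rule ccontr)
  assume *: "\<not> thesis"
  have "euclidean interior_of \<Union> (range (\<lambda>n. tame_points f (real n))) = {}"
    by (rule Baire_category_alt)
       (use * that closed_tame_points[OF assms] in \<open>auto simp: completely_metrizable_space_euclidean\<close>)
  moreover have "\<Union> (range (\<lambda>n. tame_points f (real n))) = UNIV"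
  proof (rule UNIV_eq_I[symmetric])
    fix b :: 'a
    obtain M where "b \<in> tame_points f M" using cover by blast
    then have "b \<in> tame_points f (real (nat \<lceil>M\<rceil>))"
      unfolding tame_points_def using tame_orbit_mono real_nat_ceiling_ge by blast
    then show "b \<in> \<Union> (range (\<lambda>n. tame_points f (real n)))" by blast
  qed
  ultimately show False by simp
qed

text \<open>For fixed \<open>t\<close> the flow map on \<open>V\<close> is Lipschitz by Gronwall and
  injective by uniqueness, so its image is open by invariance of domain; the saturation is the union
  of these images.\<close>

lemma open_tame_saturation:
  assumes "C1 f" "open V" "V \<subseteq> tame_points f N"
  shows "open {u t |u t. tame_orbit f N u \<and> u 0 \<in> V}"
proof -
  obtain L where L: "L > 0" "\<And>x y. x \<in> cball 0 N \<Longrightarrow> y \<in> cball 0 N \<Longrightarrow> norm (f x - f y) \<le> L * norm (x - y)"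
    using C1_lipschitz_cball[OF assms(1)] by metis
  have "\<forall>b\<in>V. \<exists>u. tame_orbit f N u \<and> u 0 = b"
    using assms(3) unfolding tame_points_def by blast
  then obtain w where w: "\<And>b. b \<in> V \<Longrightarrow> tame_orbit f N (w b)" "\<And>b. b \<in> V \<Longrightarrow> w b 0 = b"
    by metis
  have "open ((\<lambda>b. w b t) ` V)" for t
  proof (rule invariance_of_domain)
    show "continuous_on V (\<lambda>b. w b t)"
    proof (rule lipschitz_on_continuous_on[of "exp ((L + 1) * \<bar>t\<bar>)"], rule lipschitz_onI)
      fix x y assume "x \<in> V" "y \<in> V"
      then show "dist (w x t) (w y t) \<le> exp ((L + 1) * \<bar>t\<bar>) * dist x y"
        using tame_orbit_dist[OF w(1) w(1) L, of x y t 0] w(2) by (simp add: dist_norm)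
    qed simp
    show "inj_on (\<lambda>b. w b t) V"
      by (rule inj_onI) (metis tame_orbit_unique[OF assms(1)] w)
  qed fact
  moreover have "{u t |u t. tame_orbit f N u \<and> u 0 \<in> V} = (\<Union>t. (\<lambda>b. w b t) ` V)"
    (is "?A = ?B")
  proof
    show "?B \<subseteq> ?A" using w by fastforce
    show "?A \<subseteq> ?B"
    proof clarify
      fix u t assume "tame_orbit f N u" "u 0 \<in> V"
      then have "u t = w (u 0) t"
        using tame_orbit_unique[OF assms(1), of N u "w (u 0)" 0 t] w by simp
      with \<open>u 0 \<in> V\<close> show "u t \<in> ?B" by blast
    qed
  qed
  ultimately show ?thesis by auto
qed

lemma global_center_cover:
  assumes "C1 f" "global_center f"
  shows "\<exists>M. b \<in> tame_points f M"
proof -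
  have "\<exists>u T. solution_on (\<lambda>_. f) u UNIV \<and> T > 0 \<and> (\<forall>t. u (t + T) = u t) \<and> b \<in> range u"
  proof (cases "b = 0")
    case True
    moreover have "f 0 = 0"
      using assms(2) unfolding global_center_def by blast
    ultimately show ?thesis
      unfolding solution_on_def
      by (intro exI[of _ "\<lambda>_. 0"] exI[of _ 1]) auto
  next
    case False
    then show ?thesis
      using assms(2) unfolding global_center_def closed_trajectory_def by blast
  qed
  then obtain u T s where u: "solution_on (\<lambda>_. f) u UNIV" "T > 0" "\<And>t. u (t + T) = u t" "b = u s"
    by blast
  have "continuous_on UNIV u"
    using u(1) unfolding solution_on_def by (intro continuous_on_vector_derivative) auto
  then have "bounded (u ` {0..T})"
    by (meson compact_Icc compact_continuous_image compact_imp_bounded continuous_on_subset subset_UNIV)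
  then obtain R where R: "\<And>t. t \<in> {0..T} \<Longrightarrow> norm (u t) \<le> R"
    unfolding bounded_iff by blast
  \<comment> \<open>A multiple of the given period meets the lower bound required by
    \<open>tame_orbit\<close>.\<close>
  obtain k :: nat where k: "1 \<le> real k * T"
    using ex_less_of_nat_mult[OF u(2), of 1] by (auto intro: less_imp_le)
  have per: "u (t + real k * T) = u t" for t
    using periodic_int_multiple[of u T, OF u(3), of t "int k"] by simp
  have bound: "norm (u t) \<le> R" for t
  proof -
    define r where "r = t - of_int \<lfloor>t / T\<rfloor> * T"
    have "r \<in> {0..T}"
      using u(2) floor_divide_lower[of T t] floor_divide_upper[of T t] by (auto simp: r_def algebra_simps)
    moreover have "u r = u t"
      using periodic_int_multiple[of u T, OF u(3), of t "- \<lfloor>t / T\<rfloor>"] by (simp add: r_def)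
    ultimately show ?thesis using R by metis
  qed
  have "tame_orbit f (max R (real k * T)) u"
    unfolding tame_orbit_def using u(1) k per bound
    by (intro conjI exI[of _ "real k * T"]) (auto intro: max.coboundedI1)
  then show ?thesis
    unfolding u(4) by (intro exI tame_orbit_in_points)
qed

section \<open>Trapping of perturbed solutions\<close>

text \<open>The perturbation \<open>h\<close> is a function of time alone, so each planar component
  of a coupled system can be treated separately. \<open>\<eta> n\<close> bounds it on the unit
  interval number \<open>n\<close> after the start \<open>m\<close>. The conclusion says that the
  truncation was never active.\<close>

definition traps_perturbations :: "('a::euclidean_space \<Rightarrow> 'a) \<Rightarrow> real \<Rightarrow> real \<Rightarrow> 'a \<Rightarrow> bool" where
  "traps_perturbations f R \<epsilon> b \<longleftrightarrow>
     (\<forall>y h (\<eta> :: nat \<Rightarrow> real) m. y m = b \<longrightarrow>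
        (\<forall>t\<ge>m. (y has_vector_derivative f (closest_point (cball 0 R) (y t)) + h t) (at t within {m..})) \<longrightarrow>
        (\<forall>n. \<forall>t\<in>{m + real n..m + real n + 1}. norm (h t) \<le> \<eta> n) \<longrightarrow>
        (\<forall>n. sum \<eta> {..<n} < \<epsilon>) \<longrightarrow>
        (\<forall>t\<ge>m. norm (y t) \<le> R))"

text \<open>The projection onto the ball is nonexpansive and fixes the points of \<open>u\<close>,
  so the Lipschitz comparison with \<open>u\<close> holds even where \<open>y\<close> is outside the
  ball. The factor 2 is \<open>1 + (t - a)\<close> at its largest.\<close>

lemma perturbation_distance:
  assumes u: "tame_orbit f N u" and "L > 0" "0 \<le> \<eta>" "N \<le> R" "u 0 = y a" "t \<in> {a..a + 1}"
    and lip: "\<And>x y. x \<in> cball 0 R \<Longrightarrow> y \<in> cball 0 R \<Longrightarrow> norm (f x - f y) \<le> L * norm (x - y)"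
    and y: "\<And>s. s \<in> {a..t} \<Longrightarrow>
      (y has_vector_derivative f (closest_point (cball 0 R) (y s)) + h s) (at s within {a..t})"
    and h: "\<And>s. s \<in> {a..t} \<Longrightarrow> norm (h s) \<le> \<eta>"
  shows "norm (y t - u (t - a)) \<le> 2 * exp (L + 1) * \<eta>"
proof -
  have uR: "u s \<in> cball 0 R" for s
    using tame_orbit_norm[OF u, of s] \<open>N \<le> R\<close> by simp
  then have ne: "cball (0::'a) R \<noteq> {}" by blast
  have "norm (y t - u (t + - a)) \<le> exp ((L + 1) * (t - a)) * (norm (y a - u (a + - a)) + \<eta> * (1 + (t - a)))"
  proof (rule gronwall_bound[where w = "\<lambda>s. y s - u (s + - a)"
        and w' = "\<lambda>s. f (closest_point (cball 0 R) (y s)) + h s - f (u (s + - a))"])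
    fix s assume s: "s \<in> {a..t}"
    show "((\<lambda>s. y s - u (s + - a)) has_vector_derivative
        f (closest_point (cball 0 R) (y s)) + h s - f (u (s + - a))) (at s within {a..t})"
      by (intro has_vector_derivative_diff y s tame_orbit_deriv[OF tame_orbit_shift[OF u]])
    let ?P = "closest_point (cball 0 R)" and ?v = "u (s + - a)"
    have "norm (?P (y s) - ?v) \<le> norm (y s - ?v)"
      using closest_point_lipschitz[OF convex_cball closed_cball ne, of "y s" ?v]
        closest_point_self[OF uR[of "s + - a"]] by (simp add: dist_norm)
    moreover have "norm (f (?P (y s)) - f ?v) \<le> L * norm (?P (y s) - ?v)"
      by (intro lip closest_point_in_set uR closed_cball ne)
    ultimately have "norm (f (?P (y s)) - f ?v) \<le> L * norm (y s - ?v)"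
      using \<open>L > 0\<close> by (meson less_imp_le mult_left_mono order_trans)
    then show "norm (f (?P (y s)) + h s - f ?v) \<le> L * norm (y s - ?v) + \<eta>"
      using h[OF s] norm_triangle_ineq[of "f (?P (y s)) - f ?v" "h s"] by (simp add: algebra_simps)
  qed (use assms in auto)
  also have "\<dots> = exp ((L + 1) * (t - a)) * (\<eta> * (1 + (t - a)))"
    using assms(5) by simp
  also have "\<dots> \<le> exp ((L + 1) * 1) * (\<eta> * 2)"
    using assms by (intro mult_mono) (auto simp: mult_left_le)
  finally show ?thesis by (simp add: mult_ac)
qed

text \<open>Induction over unit time steps: as long as the current point is within
  \<open>\<rho>\<close> of the reference orbit \<open>w\<close>, a tame orbit passes through it, and
  that orbit serves as comparison for the next step.\<close>

lemma ex_traps_perturbations: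
  assumes "C1 f" and cover: "\<And>b. \<exists>M. b \<in> tame_points f M"
  shows "\<exists>R \<epsilon> b. R > 0 \<and> \<epsilon> > 0 \<and> traps_perturbations f R \<epsilon> b"
proof -
  obtain N where N: "interior (tame_points f N) \<noteq> {}"
    using interior_tame_points_nonempty[OF assms] .
  define U where "U = {u t |u t. tame_orbit f N u \<and> u 0 \<in> interior (tame_points f N)}"
  have "open U"
    unfolding U_def by (intro open_tame_saturation assms interior_subset) simp
  have U_sub: "U \<subseteq> tame_points f N"
    unfolding U_def using tame_orbit_in_points by blast
  obtain b where "b \<in> interior (tame_points f N)"
    using N by blast
  then obtain w where w: "tame_orbit f N w" "w 0 = b"
    using interior_subset unfolding tame_points_def by blast
  have range_U: "range w \<subseteq> U"
    using w \<open>b \<in> _\<close> unfolding U_def by blast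
  have "range w = w ` {0..N}"
    using tame_orbit_wrap[OF w(1)] by (metis image_iff image_subset_iff subset_UNIV image_mono rangeI subsetI subset_antisym)
  moreover have "continuous_on {0..N} w"
    by (rule continuous_on_vector_derivative[OF tame_orbit_deriv[OF w(1)]])
  ultimately have "compact (range w)"
    by (metis compact_Icc compact_continuous_image)
  then obtain \<rho> where \<rho>: "\<rho> > 0" "(\<Union>x\<in>range w. ball x \<rho>) \<subseteq> U"
    using compact_subset_open_imp_ball_epsilon_subset[OF _ \<open>open U\<close> range_U] by blast
  have "0 < N"
    using w(1) unfolding tame_orbit_def by linarith
  \<comment> \<open>The margin 1 leaves room for the drift away from a tame orbit within one time
    step.\<close>
  define R where "R = N + 1"
  have "N \<le> R" by (simp add: R_def)
  obtain L where L: "L > 0" "\<And>x y. x \<in> cball 0 R \<Longrightarrow> y \<in> cball 0 R \<Longrightarrow> norm (f x - f y) \<le> L * norm (x - y)"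
    using C1_lipschitz_cball[OF assms(1)] by metis
  \<comment> \<open>\<open>A\<close> converts the size of the perturbation into the displacement
    after one step, and \<open>B\<close> spreads a displacement at one point over a full period.
    Then \<open>\<epsilon>\<close> keeps the total below \<open>\<rho>\<close>, to stay in
    \<open>U\<close>, and below 1, to stay within \<open>R\<close>.\<close>
  define A where "A = 2 * exp (L + 1)"
  define B where "B = exp ((L + 1) * N)"
  define \<epsilon> where "\<epsilon> = min \<rho> 1 / (B * A)"
  have "A > 0" "B \<ge> 1" "B > 0"
    using \<open>L > 0\<close> \<open>0 < N\<close> by (auto simp: A_def B_def)
  have "\<epsilon> > 0"
    using \<rho>(1) \<open>A > 0\<close> \<open>B > 0\<close> by (simp add: \<epsilon>_def)
  have small: "B * A * c < \<rho>" "B * A * c < 1" if "c < \<epsilon>" for c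
    using that \<open>A > 0\<close> \<open>B > 0\<close> by (auto simp: \<epsilon>_def pos_less_divide_eq mult_ac)
  have "\<forall>t\<ge>m. norm (y t) \<le> R"
    if y0: "y m = b"
      and y: "\<forall>t\<ge>m. (y has_vector_derivative f (closest_point (cball 0 R) (y t)) + h t) (at t within {m..})"
      and h: "\<forall>n. \<forall>t\<in>{m + real n..m + real n + 1}. norm (h t) \<le> \<eta> n"
      and sum: "\<forall>n. sum \<eta> {..<n} < \<epsilon>"
    for y :: "real \<Rightarrow> 'a" and h m and \<eta> :: "nat \<Rightarrow> real"
  proof -
    have \<eta>_nonneg: "\<eta> n \<ge> 0" for n
      using bspec[OF spec[OF h, of n], of "m + real n"]
      by (auto intro: order_trans[OF norm_ge_zero])
    have step: "norm (y t - u (t - (m + real n))) \<le> A * \<eta> n"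
      if "tame_orbit f N u" "u 0 = y (m + real n)" "t \<in> {m + real n..m + real n + 1}" for u n t
      unfolding A_def
      by (rule perturbation_distance[where y = y and h = h and R = R, OF that(1) L(1) \<eta>_nonneg \<open>N \<le> R\<close> that(2,3) L(2)])
         (use h that(3) in \<open>auto intro!: has_vector_derivative_within_subset[OF y[rule_format]]\<close>)
    \<comment> \<open>The bound concerns the whole closed orbit through the current point: it then grows
      additively, whereas the distance of a single point could be multiplied by a constant
      factor in each step.\<close>
    have orbit: "\<exists>u. tame_orbit f N u \<and> u 0 = y (m + real n) \<and>
        (\<forall>s. \<exists>r. norm (u s - w r) \<le> B * A * sum \<eta> {..<n})" for n
    proof (induction n)
      case 0
      then show ?case
        using w y0 by (intro exI[of _ w]) (auto intro: exI[of _ "_::real"])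
    next
      case (Suc n)
      then obtain u where u: "tame_orbit f N u" "u 0 = y (m + real n)"
          "\<And>s. \<exists>r. norm (u s - w r) \<le> B * A * sum \<eta> {..<n}"
        by blast
      let ?z = "y (m + real (Suc n))"
      have z: "norm (?z - u 1) \<le> A * \<eta> n"
        using step[OF u(1,2), of "m + real (Suc n)"] by (simp add: algebra_simps)
      have B_step: "A * \<eta> n \<le> B * A * \<eta> n"
        using \<open>B \<ge> 1\<close> \<open>A > 0\<close> \<eta>_nonneg[of n] by (simp add: mult_right_mono mult_le_cancel_right1)
      obtain r where "norm (u 1 - w r) \<le> B * A * sum \<eta> {..<n}"
        using u(3) by blast
      with z B_step have "norm (?z - w r) \<le> B * A * sum \<eta> {..<Suc n}"
        using norm_triangle_ineq[of "?z - u 1" "u 1 - w r"] by (simp add: algebra_simps)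
      also have "\<dots> < \<rho>"
        using sum by (intro small) blast
      finally have "?z \<in> ball (w r) \<rho>"
        by (simp add: dist_norm norm_minus_commute)
      then have "?z \<in> tame_points f N"
        using \<rho>(2) U_sub by blast
      then obtain v where v: "tame_orbit f N v" "v 0 = ?z"
        unfolding tame_points_def by auto
      have "\<exists>r. norm (v s - w r) \<le> B * A * sum \<eta> {..<Suc n}" for s
      proof -
        obtain s' where s': "s' \<in> {0..N}" "v s' = v s"
          using tame_orbit_wrap[OF v(1)] by metis
        \<comment> \<open>The new orbit \<open>v\<close> is compared with the old one advanced by
          the step length 1, since \<open>v 0\<close> is close to \<open>u 1\<close>; as
          \<open>s'\<close> is at most \<open>N\<close>, the exponential is at most
          \<open>B\<close>.\<close>
        have "norm (v s' - u (s' + 1)) \<le> exp ((L + 1) * \<bar>s' - 0\<bar>) * norm (v 0 - u (0 + 1))"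
          by (rule tame_orbit_dist[OF v(1) tame_orbit_shift[OF u(1)] L(1)]) (auto simp: R_def intro!: L(2))
        also have "\<dots> \<le> B * (A * \<eta> n)"
          using s'(1) z v(2) \<open>L > 0\<close> by (intro mult_mono) (auto simp: B_def)
        finally have "norm (v s - u (s' + 1)) \<le> B * A * \<eta> n"
          by (simp add: s'(2) mult_ac)
        moreover obtain r where "norm (u (s' + 1) - w r) \<le> B * A * sum \<eta> {..<n}"
          using u(3) by blast
        ultimately have "norm (v s - w r) \<le> B * A * sum \<eta> {..<Suc n}"
          using norm_triangle_ineq[of "v s - u (s' + 1)" "u (s' + 1) - w r"] by (simp add: algebra_simps)
        then show ?thesis by blast
      qed
      with v show ?case by blast
    qed
    show ?thesis
    proof (intro allI impI)
      fix t assume t: "m \<le> t"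
      define n where "n = nat \<lfloor>t - m\<rfloor>"
      have tn: "t \<in> {m + real n..m + real n + 1}"
        using t unfolding n_def by (auto simp: algebra_simps) linarith+
      obtain u where u: "tame_orbit f N u" "u 0 = y (m + real n)"
        using orbit by blast
      have "\<eta> n \<le> sum \<eta> {..<Suc n}"
        by (simp add: sum_nonneg \<eta>_nonneg)
      then have "B * A * \<eta> n < 1"
        using sum by (intro small) (meson le_less_trans)
      moreover have "A * \<eta> n \<le> B * A * \<eta> n"
        using \<open>B \<ge> 1\<close> \<open>A > 0\<close> \<eta>_nonneg[of n] by (simp add: mult_right_mono mult_le_cancel_right1)
      ultimately have "norm (y t - u (t - (m + real n))) \<le> 1"
        using step[OF u tn] by linarith
      then show "norm (y t) \<le> R"
        using tame_orbit_norm[OF u(1), of "t - (m + real n)"]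
          norm_triangle_ineq[of "y t - u (t - (m + real n))" "u (t - (m + real n))"]
        by (simp add: R_def)
    qed
  qed
  then have "traps_perturbations f R \<epsilon> b"
    unfolding traps_perturbations_def by blast
  with \<open>\<epsilon> > 0\<close> \<open>0 < N\<close> show ?thesis
    by (intro exI[of _ R] exI[of _ \<epsilon>] exI[of _ b]) (auto simp: R_def)
qed

section \<open>Decay of the perturbation and the coupled system\<close>

text \<open>Either alternative makes \<open>t powr p * norm (g t x)\<close> eventually less than 1
  uniformly on \<open>K\<close>; in the second, monotonicity bounds \<open>\<alpha>\<close> on
  \<open>K\<close> by its value at a bound of the norms, and \<open>\<beta>\<close> tends to
  0.\<close>

lemma decay_on_compact:
  fixes g :: "real \<Rightarrow> 'a::real_normed_vector \<Rightarrow> 'b::real_normed_vector"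
  assumes "compact K"
    and decay:
      "(\<forall>K. compact K \<longrightarrow>
          uniform_limit K (\<lambda>t x. t powr p * norm (g t x)) (\<lambda>_. 0) at_top)
       \<or>
       (\<exists>\<alpha> \<beta> :: real \<Rightarrow> real.
          continuous_on {0..} \<alpha> \<and> (\<forall>s\<ge>0. \<alpha> s > 0) \<and> mono_on {0..} \<alpha> \<and>
          continuous_on {0<..} \<beta> \<and> (\<forall>t>0. \<beta> t > 0) \<and> antimono_on {0<..} \<beta> \<and>
          (\<beta> \<longlongrightarrow> 0) at_top \<and>
          (\<forall>t>0. \<forall>x. t powr p * norm (g t x) \<le> \<alpha> (norm x) * \<beta> t))"
  shows "\<forall>\<^sub>F t in at_top. \<forall>x\<in>K. norm (g t x) \<le> t powr - p"
proof -
  have "\<forall>\<^sub>F t in at_top. \<forall>x\<in>K. t powr p * norm (g t x) < 1"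
    using decay
  proof
    assume "\<forall>K. compact K \<longrightarrow> uniform_limit K (\<lambda>t x. t powr p * norm (g t x)) (\<lambda>_. 0) at_top"
    then have "uniform_limit K (\<lambda>t x. t powr p * norm (g t x)) (\<lambda>_. 0) at_top"
      using assms(1) by blast
    from uniform_limitD[OF this zero_less_one] show ?thesis
      by (auto elim!: eventually_mono simp: dist_norm abs_mult)
  next
    assume "\<exists>\<alpha> \<beta> :: real \<Rightarrow> real.
          continuous_on {0..} \<alpha> \<and> (\<forall>s\<ge>0. \<alpha> s > 0) \<and> mono_on {0..} \<alpha> \<and>
          continuous_on {0<..} \<beta> \<and> (\<forall>t>0. \<beta> t > 0) \<and> antimono_on {0<..} \<beta> \<and>
          (\<beta> \<longlongrightarrow> 0) at_top \<and>
          (\<forall>t>0. \<forall>x. t powr p * norm (g t x) \<le> \<alpha> (norm x) * \<beta> t)"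
    then obtain \<alpha> \<beta> :: "real \<Rightarrow> real" where \<alpha>: "\<And>s. s \<ge> 0 \<Longrightarrow> \<alpha> s > 0" "mono_on {0..} \<alpha>"
      and \<beta>: "\<And>t. t > 0 \<Longrightarrow> \<beta> t > 0" "(\<beta> \<longlongrightarrow> 0) at_top"
      and le: "\<And>t x. t > 0 \<Longrightarrow> t powr p * norm (g t x) \<le> \<alpha> (norm x) * \<beta> t"
      by blast
    obtain B where B: "B > 0" "\<And>x. x \<in> K \<Longrightarrow> norm x \<le> B"
      using compact_imp_bounded[OF assms(1)] unfolding bounded_pos by blast
    have "\<alpha> B > 0"
      using \<alpha>(1) B(1) by simp
    then have "\<forall>\<^sub>F t in at_top. \<beta> t < 1 / \<alpha> B"
      by (intro order_tendstoD(2)[OF \<beta>(2)]) simp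
    then show ?thesis
      using eventually_gt_at_top[of 0]
    proof eventually_elim
      case (elim t)
      show ?case
      proof
        fix x assume x: "x \<in> K"
        have "t powr p * norm (g t x) \<le> \<alpha> (norm x) * \<beta> t"
          using le elim by blast
        also have "\<dots> \<le> \<alpha> B * \<beta> t"
          using \<beta>(1)[of t] elim B x
          by (intro mult_right_mono mono_onD[OF \<alpha>(2)]) auto
        also have "\<dots> < 1"
          using elim(1) \<open>\<alpha> B > 0\<close> by (simp add: field_simps)
        finally show "t powr p * norm (g t x) < 1" .
      qed
    qed
  qed
  then show ?thesis
    using eventually_gt_at_top[of 0]
    by eventually_elim (auto simp: powr_minus field_simps intro: less_imp_le)
qed

theorem theorem4p2:
  fixes f :: "'n::finite \<Rightarrow> real^2 \<Rightarrow> real^2"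
    and g :: "real \<Rightarrow> (real^2)^'n \<Rightarrow> (real^2)^'n"
    and p :: real
  assumes f_C1: "\<And>k. C1 (f k)"
    and f_center: "\<And>k. global_center (f k)"
    and g_C01: "C01 g"
    and p: "p > 1"
    and decay:
      "(\<forall>K. compact K \<longrightarrow>
          uniform_limit K (\<lambda>t x. t powr p * norm (g t x)) (\<lambda>_. 0) at_top)
       \<or>
       (\<exists>\<alpha> \<beta> :: real \<Rightarrow> real.
          continuous_on {0..} \<alpha> \<and> (\<forall>s\<ge>0. \<alpha> s > 0) \<and> mono_on {0..} \<alpha> \<and>
          continuous_on {0<..} \<beta> \<and> (\<forall>t>0. \<beta> t > 0) \<and> antimono_on {0<..} \<beta> \<and>
          (\<beta> \<longlongrightarrow> 0) at_top \<and>
          (\<forall>t>0. \<forall>x. t powr p * norm (g t x) \<le> \<alpha> (norm x) * \<beta> t))"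
  shows "\<exists>t0 x. solution_on (\<lambda>t y. (\<chi> k. f k (y $ k)) + g t y) x {t0..} \<and> bounded (x ` {t0..})"
proof -
  have "\<exists>R \<epsilon> b. R > 0 \<and> \<epsilon> > 0 \<and> traps_perturbations (f k) R \<epsilon> b" for k
    by (rule ex_traps_perturbations[OF f_C1 global_center_cover[OF f_C1 f_center]])
  then obtain R \<epsilon> b where R: "\<And>k. R k > 0" and \<epsilon>: "\<And>k. \<epsilon> k > (0::real)"
    and traps: "\<And>k. traps_perturbations (f k) (R k) (\<epsilon> k) (b k)"
    by metis
  define K :: "((real^2)^'n) set" where "K = {y. \<forall>k. norm (y $ k) \<le> R k}"
  \<comment> \<open>Projecting each plane onto its own disc keeps component \<open>k\<close> of the
    unperturbed part dependent on \<open>y $ k\<close> only, as \<open>traps_perturbations\<close>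
    requires.\<close>
  define P :: "(real^2)^'n \<Rightarrow> (real^2)^'n" where "P y = (\<chi> k. closest_point (cball 0 (R k)) (y $ k))" for y
  have ne: "cball (0::real^2) (R k) \<noteq> {}" for k
    using R[of k] by (simp add: less_imp_le)
  have "bounded K"
    unfolding bounded_iff
  proof (intro exI ballI)
    fix y assume "y \<in> K"
    then show "norm y \<le> (\<Sum>k\<in>UNIV. R k)"
      unfolding norm_vec_def[of y] K_def
      by (intro order_trans[OF L2_set_le_sum] sum_mono) auto
  qed
  moreover have "closed K"
    unfolding K_def by (intro closed_Collect_all closed_Collect_le continuous_intros)
  ultimately have "compact K"
    by (simp add: compact_eq_bounded_closed)
  have "convex K"
  proof -
    have "K = (\<Inter>k. (\<lambda>y. y $ k) -` cball 0 (R k))"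
      by (auto simp: K_def)
    then show ?thesis
      by (auto intro!: convex_INT convex_linear_vimage bounded_linear.linear[OF bounded_linear_vec_nth])
  qed
  have P_in: "P y \<in> K" for y
    using closest_point_in_set[OF closed_cball ne] by (auto simp: K_def P_def)
  have P_id: "P y = y" if "y \<in> K" for y
  proof -
    have "closest_point (cball 0 (R k)) (y $ k) = y $ k" for k
      using that by (intro closest_point_self) (simp add: K_def)
    then show ?thesis by (simp add: P_def)
  qed
  have P_lip: "norm (P x - P y) \<le> norm (x - y)" for x y
    unfolding norm_vec_def[of "P x - P y"] norm_vec_def[of "x - y"]
    by (intro L2_set_mono)
       (auto simp: P_def simp flip: dist_norm intro!: closest_point_lipschitz convex_cball closed_cball ne)
  have contP: "continuous_on UNIV P"
    by (rule lipschitz_on_continuous_on[of 1], rule lipschitz_onI) (use P_lip in \<open>auto simp: dist_norm\<close>)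
  define F where "F t y = (\<chi> k. f k (y $ k)) + g t y" for t y
  have contF: "continuous_on UNIV (\<lambda>(t, y). F t (P y))"
  proof -
    have "continuous_on UNIV (\<lambda>(t, y). g t y)"
      using g_C01 unfolding C01_def by blast
    then have "continuous_on UNIV (\<lambda>z. (\<lambda>(t, y). g t y) (fst z, P (snd z)))"
      by (rule continuous_on_compose2)
         (auto intro!: continuous_intros continuous_on_compose2[OF contP])
    moreover have "continuous_on UNIV (\<lambda>z::real \<times> _. f k (P (snd z) $ k))" for k
      by (rule continuous_on_compose2[OF C1_continuous[OF f_C1]])
         (auto intro!: continuous_intros continuous_on_compose2[OF contP])
    ultimately show ?thesis
      unfolding F_def case_prod_beta by (intro continuous_intros) auto
  qed
  have lipF: "\<exists>L>0. \<forall>t\<in>{a..b}. \<forall>x y. norm (F t (P x) - F t (P y)) \<le> L * norm (x - y)" for a b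
  proof -
    obtain Lg where Lg: "Lg > 0"
      "\<And>t x y. t \<in> {a..b} \<Longrightarrow> x \<in> K \<Longrightarrow> y \<in> K \<Longrightarrow> norm (g t x - g t y) \<le> Lg * norm (x - y)"
      using C01_lipschitz_compact[OF g_C01 \<open>compact K\<close> \<open>convex K\<close>] by metis
    have "\<forall>k. \<exists>L>0. \<forall>x\<in>cball 0 (R k). \<forall>y\<in>cball 0 (R k). norm (f k x - f k y) \<le> L * norm (x - y)"
      using C1_lipschitz_cball[OF f_C1] by metis
    then obtain Lf where Lf: "\<And>k. Lf k > 0"
      "\<And>k x y. x \<in> cball 0 (R k) \<Longrightarrow> y \<in> cball 0 (R k) \<Longrightarrow> norm (f k x - f k y) \<le> Lf k * norm (x - y)"
      by metis
    have F_lip: "norm (F t x - F t y) \<le> ((\<Sum>k\<in>UNIV. Lf k) + Lg) * norm (x - y)"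
      if "t \<in> {a..b}" "x \<in> K" "y \<in> K" for t x y
    proof -
      have "norm ((\<chi> k. f k (x $ k)) - (\<chi> k. f k (y $ k))) \<le> (\<Sum>k\<in>UNIV. norm (f k (x $ k) - f k (y $ k)))"
        unfolding norm_vec_def[of "(\<chi> k. f k (x $ k)) - (\<chi> k. f k (y $ k))"] by (rule order_trans[OF L2_set_le_sum]) auto
      also have "\<dots> \<le> (\<Sum>k\<in>UNIV. Lf k * norm (x - y))"
      proof (rule sum_mono)
        fix k
        have "norm (f k (x $ k) - f k (y $ k)) \<le> Lf k * norm ((x - y) $ k)"
          using that Lf(2)[of "x $ k" k "y $ k"] by (simp add: K_def)
        also have "\<dots> \<le> Lf k * norm (x - y)"
          using Lf(1)[of k] Finite_Cartesian_Product.norm_nth_le[of "x - y" k] by (intro mult_left_mono) auto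
        finally show "norm (f k (x $ k) - f k (y $ k)) \<le> Lf k * norm (x - y)" .
      qed
      finally have 1: "norm ((\<chi> k. f k (x $ k)) - (\<chi> k. f k (y $ k))) \<le> (\<Sum>k\<in>UNIV. Lf k) * norm (x - y)"
        by (simp add: sum_distrib_right)
      have "F t x - F t y = ((\<chi> k. f k (x $ k)) - (\<chi> k. f k (y $ k))) + (g t x - g t y)"
        by (simp add: F_def)
      then have "norm (F t x - F t y)
          \<le> norm ((\<chi> k. f k (x $ k)) - (\<chi> k. f k (y $ k))) + norm (g t x - g t y)"
        by (metis norm_triangle_ineq)
      with 1 Lg(2)[OF that] show ?thesis
        by (simp add: algebra_simps)
    qed
    have pos: "(\<Sum>k\<in>UNIV. Lf k) + Lg > 0"
      using Lg(1) Lf(1) by (intro add_nonneg_pos sum_nonneg) (auto intro: less_imp_le)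
    show ?thesis
    proof (intro exI conjI ballI allI)
      fix t x y assume "t \<in> {a..b}"
      then have "norm (F t (P x) - F t (P y)) \<le> ((\<Sum>k\<in>UNIV. Lf k) + Lg) * norm (P x - P y)"
        by (intro F_lip P_in)
      also have "\<dots> \<le> ((\<Sum>k\<in>UNIV. Lf k) + Lg) * norm (x - y)"
        using pos by (intro mult_left_mono P_lip) auto
      finally show "norm (F t (P x) - F t (P y)) \<le> ((\<Sum>k\<in>UNIV. Lf k) + Lg) * norm (x - y)" .
    qed (rule pos)
  qed
  obtain t1 where t1: "\<And>t x. t \<ge> t1 \<Longrightarrow> x \<in> K \<Longrightarrow> norm (g t x) \<le> t powr - p"
    using decay_on_compact[OF \<open>compact K\<close> decay] unfolding eventually_at_top_linorder by blast
  \<comment> \<open>One starting time must serve all of the finitely many components.\<close>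
  define e where "e = Min (range \<epsilon>)"
  have e: "e > 0" "\<And>k. e \<le> \<epsilon> k"
    using \<epsilon> by (auto simp: e_def)
  have "summable (\<lambda>n. real n powr - p)"
    using p by (simp add: summable_real_powr_iff)
  then obtain M where M: "\<And>m n. m \<ge> M \<Longrightarrow> norm (\<Sum>i = m..<n. real i powr - p) < e"
    using e(1) unfolding summable_Cauchy by blast
  \<comment> \<open>A natural starting time turns the step bounds into consecutive terms of the
    series of \<open>real i powr - p\<close>. It is past \<open>M\<close> for a small tail, past
    \<open>t1\<close> for the decay, and positive so that the power is decreasing from there
    on.\<close>
  define m where "m = max (max M 1) (nat \<lceil>t1\<rceil>)"
  have m: "m \<ge> M" "m \<ge> 1" "real m \<ge> t1"
    using real_nat_ceiling_ge[of t1] by (auto simp: m_def le_max_iff_disj of_nat_max)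
  have tail: "(\<Sum>n<N. (real m + real n) powr - p) < e" for N
  proof -
    have "(\<Sum>n<N. (real m + real n) powr - p) = (\<Sum>i = m..<m + N. real i powr - p)"
      by (subst sum.atLeastLessThan_shift_0) (simp add: lessThan_atLeast0)
    also have "\<dots> < e"
      using M[OF m(1), of "m + N"] by simp
    finally show ?thesis .
  qed
  obtain y where y: "y (real m) = (\<chi> k. b k)" "solution_on (\<lambda>t y. F t (P y)) y {real m..}"
    using picard_lindelof_atLeast[OF contF lipF] by metis
  \<comment> \<open>The coupling through \<open>g\<close> is frozen along the solution
    \<open>y\<close> already found, so for component \<open>k\<close> it is a given function of
    time.\<close>
  have "norm (y t $ k) \<le> R k" if "t \<ge> real m" for t k
  proof (rule traps[of k, unfolded traps_perturbations_def, rule_format,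
        where y = "\<lambda>t. y t $ k" and m = "real m" and \<eta> = "\<lambda>n. (real m + real n) powr - p"
          and h = "\<lambda>t. g t (P (y t)) $ k"])
    show "y (real m) $ k = b k" using y(1) by simp
    show "((\<lambda>t. y t $ k) has_vector_derivative
        f k (closest_point (cball 0 (R k)) (y s $ k)) + g s (P (y s)) $ k) (at s within {real m..})"
      if "s \<ge> real m" for s
    proof -
      have "(y has_vector_derivative F s (P (y s))) (at s within {real m..})"
        using y(2) that by (simp add: solution_on_def)
      from bounded_linear.has_vector_derivative[OF bounded_linear_vec_nth[of k] this] show ?thesis
        by (simp add: F_def P_def)
    qed
    show "norm (g s (P (y s)) $ k) \<le> (real m + real n) powr - p"
      if "s \<in> {real m + real n..real m + real n + 1}" for s n
    proof -
      have "norm (g s (P (y s)) $ k) \<le> norm (g s (P (y s)))"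
        by (rule Finite_Cartesian_Product.norm_nth_le)
      also have "\<dots> \<le> s powr - p"
        using that m(3) by (intro t1 P_in) auto
      also have "\<dots> \<le> (real m + real n) powr - p"
        using that m(2) p by (intro powr_mono2') auto
      finally show ?thesis .
    qed
    show "(\<Sum>n<N. (real m + real n) powr - p) < \<epsilon> k" for N
      using tail[of N] e(2)[of k] by simp
  qed fact
  then have yK: "y t \<in> K" if "t \<in> {real m..}" for t
    using that by (simp add: K_def)
  \<comment> \<open>Since \<open>y\<close> never leaves \<open>K\<close>, \<open>P\<close> is the
    identity along it and the truncated equation is the original one.\<close>
  then have "solution_on F y {real m..}"
    using y(2) unfolding solution_on_def by (simp add: P_id)
  moreover have "bounded (y ` {real m..})"
    using yK by (intro bounded_subset[OF \<open>bounded K\<close>]) auto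
  ultimately show ?thesis
    unfolding F_def by blast
qed

end
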